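(* Let $1\le n\le p$ be integers and let $X\in\mathbb{R}^{n\times p}$ be a matrix of full rank $n$. Let $\delta$ be the distortion of $\ker(X)$ and let $\rho_n>0$ be the smallest singular value of $X$. Then, for all $\gamma\in\mathbb{R}^p$, $$\|\gamma\|_{\ell_2}\le \frac{\delta}{\sqrt p}\,\|\gamma\|_{\ell_1}+\frac{2\delta}{\rho_n}\,\|X\gamma\|_{\ell_2}.$$ Equivalently, $$\Big\{\gamma\in\mathbb{R}^p \ :\ \frac{\delta}{\sqrt p}\|\gamma\|_{\ell_1}+\frac{2\delta}{\rho_n}\|X\gamma\|_{\ell_2}\le 1\Big\}\subset B_2^p,$$ where $B_2^p$ denotes the Euclidean unit ball of $\mathbb{R}^p$.
   Context: For $x\in\mathbb{R}^m$, $\|x\|_{\ell_1}=\sum_i|x_i|$ and $\|x\|_{\ell_2}=(\sum_i x_i^2)^{1/2}$. The singular values of the rank-$n$ matrix $X\in\mathbb{R}^{n\times p}$ ($n\le p$) are $\rho_1\ge\dots\ge\rho_n>0$ (the square roots of the eigenvalues of $XX^\top$). A subspace $\Gamma\subset\mathbb{R}^p$ has distortion $\delta$, with $1\le\delta\le\sqrt p$, if $\|x\|_{\ell_1}\le\sqrt p\,\|x\|_{\ell_2}\le\delta\,\|x\|_{\ell_1}$ for all $x\in\Gamma$. "The distortion" of $\Gamma$ is the smallest such $\delta$, i.e. $\delta=\sup_{x\in\Gamma\setminus\{0\}}\sqrt p\,\|x\|_{\ell_2}/\|x\|_{\ell_1}$ (and $\delta=1$ if $\Gamma=\{0\}$).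 *)

theory Defs
  imports "HOL-Analysis.Analysis"
begin

text \<open>The \<open>\<ell>\<^sub>2\<close> norm is the library's \<^const>\<open>norm\<close> on \<open>real ^ 'n\<close>.\<close>

definition l1_norm :: "real ^ 'n \<Rightarrow> real" where
  "l1_norm x = (\<Sum>i\<in>UNIV. \<bar>x $ i\<bar>)"

definition matrix_kernel :: "real ^ 'p ^ 'n \<Rightarrow> (real ^ 'p) set" where
  "matrix_kernel X = {x. X *v x = 0}"

definition eigenvalue :: "real ^ 'n ^ 'n \<Rightarrow> real \<Rightarrow> bool" where
  "eigenvalue A l \<longleftrightarrow> (\<exists>v. v \<noteq> 0 \<and> A *v v = l *\<^sub>R v)"

text \<open>Singular values of an \<open>n \<times> p\<close> matrix with \<open>n \<le> p\<close>, as a set: multiplicities are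
  irrelevant for the smallest one.  The matrix \<open>X X\<^sup>T\<close> is symmetric positive semidefinite, so this set is
  finite, nonempty and nonnegative.\<close>

definition singular_values :: "real ^ 'p ^ 'n \<Rightarrow> real set" where
  "singular_values X = {sqrt l | l. eigenvalue (X ** transpose X) l}"

definition smallest_singular_value :: "real ^ 'p ^ 'n \<Rightarrow> real" where
  "smallest_singular_value X = Min (singular_values X)"

definition has_distortion :: "(real ^ 'p) set \<Rightarrow> real \<Rightarrow> bool" where
  "has_distortion \<Gamma> \<delta> \<longleftrightarrow>
     1 \<le> \<delta> \<and> \<delta> \<le> sqrt (real CARD('p)) \<and>
     (\<forall>x\<in>\<Gamma>. l1_norm x \<le> sqrt (real CARD('p)) * norm x \<and>
             sqrt (real CARD('p)) * norm x \<le> \<delta> * l1_norm x)"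

text \<open>The least element exists for every \<open>\<Gamma>\<close> (see \<open>has_distortion_distortion\<close> below), and
  it agrees with the supremum formula (see \<open>distortion_eq_SUP\<close>).\<close>

definition distortion :: "(real ^ 'p) set \<Rightarrow> real" where
  "distortion \<Gamma> = (LEAST \<delta>. has_distortion \<Gamma> \<delta>)"

lemma norm_le_l1_norm: "norm x \<le> l1_norm x"
  unfolding l1_norm_def by (rule norm_le_l1_cart)

lemma l1_norm_pos: "x \<noteq> 0 \<Longrightarrow> 0 < l1_norm x"
  using norm_le_l1_norm[of x] by (smt (verit) zero_less_norm_iff)

lemma l1_norm_le_sqrt_norm:
  fixes x :: "real ^ 'p"
  shows "l1_norm x \<le> sqrt (real CARD('p)) * norm x"
proof -
  have "(\<Sum>i\<in>UNIV. \<bar>x $ i\<bar> * \<bar>1\<bar>) \<le> L2_set (\<lambda>i. x $ i) UNIV * L2_set (\<lambda>i. 1) (UNIV :: 'p set)"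
    by (rule L2_set_mult_ineq)
  then show ?thesis
    by (simp add: l1_norm_def norm_vec_def L2_set_constant L2_set_def mult.commute)
qed

lemma sqrt_card_ge_1: "1 \<le> sqrt (real CARD('p::finite))"
  using one_le_card_finite[where 'a = 'p] by (simp del: one_le_card_finite)

lemma has_distortion_sqrt_card:
  fixes \<Gamma> :: "(real ^ 'p) set"
  shows "has_distortion \<Gamma> (sqrt (real CARD('p)))"
  unfolding has_distortion_def
  using sqrt_card_ge_1[where 'p = 'p] l1_norm_le_sqrt_norm norm_le_l1_norm
  by (auto intro!: mult_left_mono)

lemma is_least_distortion:
  fixes \<Gamma> :: "(real ^ 'p) set"
  shows "has_distortion \<Gamma> (distortion \<Gamma>) \<and> (\<forall>\<delta>. has_distortion \<Gamma> \<delta> \<longrightarrow> distortion \<Gamma> \<le> \<delta>)"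
proof -
  let ?S = "{\<delta>. has_distortion \<Gamma> \<delta>}"
  have "closed ?S"
    unfolding has_distortion_def Ball_def
    by (intro closed_Collect_conj closed_Collect_all closed_Collect_imp closed_Collect_le
        continuous_intros open_Collect_const)
  moreover have "?S \<noteq> {}" using has_distortion_sqrt_card by blast
  moreover have bdd: "bdd_below ?S" by (rule bdd_belowI[of _ 1]) (auto simp: has_distortion_def)
  ultimately have "Inf ?S \<in> ?S" by (intro closed_contains_Inf)
  then have 1: "has_distortion \<Gamma> (Inf ?S)" by simp
  have 2: "Inf ?S \<le> \<delta>" if "has_distortion \<Gamma> \<delta>" for \<delta>
    using that bdd by (intro cInf_lower) auto
  have "distortion \<Gamma> = Inf ?S"
    unfolding distortion_def by (rule Least_equality) (use 1 2 in auto)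
  then show ?thesis using 1 2 by simp
qed

lemma has_distortion_distortion: "has_distortion \<Gamma> (distortion \<Gamma>)"
  using is_least_distortion by blast

lemma distortion_le: "has_distortion \<Gamma> \<delta> \<Longrightarrow> distortion \<Gamma> \<le> \<delta>"
  using is_least_distortion by blast

lemma distortion_eq_SUP:
  fixes \<Gamma> :: "(real ^ 'p) set"
  shows "distortion \<Gamma> = (if \<Gamma> \<subseteq> {0} then 1
           else (SUP x\<in>\<Gamma> - {0}. sqrt (real CARD('p)) * norm x / l1_norm x))"
proof (cases "\<Gamma> \<subseteq> {0}")
  case True
  then have "has_distortion \<Gamma> 1"
    using sqrt_card_ge_1[where 'p = 'p] by (auto simp: has_distortion_def l1_norm_def)
  then show ?thesis
    using True distortion_le[of \<Gamma> 1] has_distortion_distortion[of \<Gamma>]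
    by (auto simp: has_distortion_def)
next
  case False
  let ?f = "\<lambda>x :: real ^ 'p. sqrt (real CARD('p)) * norm x / l1_norm x"
  let ?s = "SUP x\<in>\<Gamma> - {0}. ?f x"
  from False obtain z where z: "z \<in> \<Gamma>" "z \<noteq> 0" by blast
  have d: "?f x \<le> \<delta>" if "has_distortion \<Gamma> \<delta>" "x \<in> \<Gamma> - {0}" for x \<delta>
    using that l1_norm_pos[of x] by (auto simp: has_distortion_def divide_le_eq)
  have le: "?s \<le> \<delta>" if "has_distortion \<Gamma> \<delta>" for \<delta>
    using z d[OF that] by (intro cSUP_least) auto
  have up: "?f x \<le> ?s" if "x \<in> \<Gamma> - {0}" for x
    using that d[OF has_distortion_distortion] by (intro cSUP_upper bdd_aboveI2) auto
  have "1 \<le> ?f z" using l1_norm_le_sqrt_norm[of z] l1_norm_pos[of z] z by simp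
  also have "\<dots> \<le> ?s" using up z by blast
  finally have "1 \<le> ?s" .
  moreover have "sqrt (real CARD('p)) * norm x \<le> ?s * l1_norm x" if "x \<in> \<Gamma>" for x
  proof (cases "x = 0")
    case True
    then show ?thesis by (simp add: l1_norm_def)
  next
    case False
    then show ?thesis using up[of x] that l1_norm_pos[of x] by (simp add: divide_le_eq)
  qed
  ultimately have "has_distortion \<Gamma> ?s"
    using le[OF has_distortion_sqrt_card] l1_norm_le_sqrt_norm by (auto simp: has_distortion_def)
  then have "distortion \<Gamma> = ?s"
    using distortion_le le[OF has_distortion_distortion] by (meson order_antisym)
  then show ?thesis using False by simp
qed

end

theory Submission
  imports Defs
begin

text \<open>Split \<open>\<gamma> = z + w\<close> into its component \<open>z\<close> in \<open>ker X\<close> and its component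
  \<open>w = X\<^sup>T u\<close> in the row space, where \<open>u\<close> solves \<open>X X\<^sup>T u = X \<gamma>\<close>; the solution exists because
  \<open>X X\<^sup>T\<close> is positive definite when \<open>X\<close> has full row rank.

  The row space part is controlled by the smallest singular value.  For a symmetric matrix the
  minimum of the Rayleigh quotient is an eigenvalue (\<open>symmetric_matrix_min_eigenvalue\<close>), hence
  \<open>\<rho>\<^sup>2 \<parallel>u\<parallel>\<^sup>2 \<le> \<langle>u, X X\<^sup>T u\<rangle> = \<parallel>w\<parallel>\<^sup>2\<close> (\<open>smallest_singular_value_bound\<close>), and Cauchy-Schwarz in
  \<open>\<parallel>w\<parallel>\<^sup>2 = \<langle>u, X w\<rangle>\<close> gives \<open>\<rho> \<parallel>w\<parallel> \<le> \<parallel>X w\<parallel> = \<parallel>X \<gamma>\<parallel>\<close> (\<open>row_space_component\<close>).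

  The kernel part is controlled by the distortion: \<open>\<parallel>z\<parallel>\<^sub>2 \<le> (\<delta> / \<surd>p) \<parallel>z\<parallel>\<^sub>1\<close>, and
  \<open>\<parallel>z\<parallel>\<^sub>1 \<le> \<parallel>\<gamma>\<parallel>\<^sub>1 + \<parallel>w\<parallel>\<^sub>1 \<le> \<parallel>\<gamma>\<parallel>\<^sub>1 + \<surd>p \<parallel>w\<parallel>\<^sub>2\<close>.  Altogether
  \<open>\<parallel>\<gamma>\<parallel>\<^sub>2 \<le> (\<delta> / \<surd>p) \<parallel>\<gamma>\<parallel>\<^sub>1 + (\<delta> + 1) \<parallel>w\<parallel>\<^sub>2\<close>, and \<open>\<delta> + 1 \<le> 2 \<delta>\<close>.\<close>

lemma inner_transpose_matrix_vector:
  fixes A :: "real ^ 'n ^ 'm"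
  shows "(transpose A *v x) \<bullet> y = x \<bullet> (A *v y)"
  by (simp add: dot_lmul_matrix)

lemma inner_gram_matrix:
  fixes X :: "real ^ 'p ^ 'n"
  shows "u \<bullet> ((X ** transpose X) *v u) = (norm (transpose X *v u))\<^sup>2"
  by (metis inner_transpose_matrix_vector matrix_vector_mul_assoc power2_norm_eq_inner)

lemma transpose_gram_matrix: "transpose (X ** transpose X) = X ** transpose (X :: real ^ 'p ^ 'n)"
  by (simp add: matrix_transpose_mul)

lemma l1_norm_diff_le: "l1_norm (x - y) \<le> l1_norm x + l1_norm y"
  unfolding l1_norm_def sum.distrib[symmetric] by (rule sum_mono) simp

text \<open>If \<open>\<langle>v, B v\<rangle> = 0\<close> then \<open>v\<close> minimises the form, so its derivative \<open>2 \<langle>h, B v\<rangle>\<close> at \<open>v\<close>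
  vanishes in every direction \<open>h\<close>, in particular in the direction \<open>h = B v\<close>.\<close>

lemma psd_matrix_isotropic_imp_kernel:
  fixes B :: "real ^ 'n ^ 'n"
  assumes sym: "transpose B = B"
    and psd: "\<And>u. 0 \<le> u \<bullet> (B *v u)"
    and v: "v \<bullet> (B *v v) = 0"
  shows "B *v v = 0"
proof (rule ccontr)
  assume "B *v v \<noteq> 0"
  define h where "h = B *v v"
  define a where "a = h \<bullet> h"
  define b where "b = h \<bullet> (B *v h)"
  have a: "0 < a" using \<open>B *v v \<noteq> 0\<close> by (simp add: a_def h_def)
  have b: "0 \<le> b" unfolding b_def by (rule psd)
  (* The step length is about the minimiser a / b of - 2 s a + s^2 b; adding 1 to the
     denominator covers b = 0. *)
  define s where "s = a / (b + 1)"
  have "v \<bullet> (B *v h) = a"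
    using inner_transpose_matrix_vector[of B v h] by (simp add: sym a_def h_def)
  then have "(v - s *\<^sub>R h) \<bullet> (B *v (v - s *\<^sub>R h)) = s\<^sup>2 * b - 2 * s * a"
    using v unfolding a_def b_def
    by (simp add: matrix_vector_mult_diff_distrib matrix_vector_mult_scaleR inner_diff_left
        inner_diff_right power2_eq_square algebra_simps flip: h_def)
  then have "2 * s * a \<le> s\<^sup>2 * b" using psd[of "v - s *\<^sub>R h"] by simp
  moreover have "0 < s" using a b by (simp add: s_def)
  ultimately have "2 * a \<le> s * b" by (simp add: power2_eq_square)
  moreover have "s * b \<le> a" using a b by (simp add: s_def divide_le_eq)
  ultimately show False using a by simp
qed

text \<open>The quadratic form attains its minimum \<open>m\<close> on the compact unit sphere, at \<open>v\<close> say.  Then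
  \<open>A - m I\<close> is positive semidefinite and its form vanishes at \<open>v\<close>, which is therefore an
  eigenvector for \<open>m\<close>.\<close>

lemma symmetric_matrix_min_eigenvalue:
  fixes A :: "real ^ 'n ^ 'n"
  assumes sym: "transpose A = A"
  obtains m where "eigenvalue A m" "\<And>u. m * (norm u)\<^sup>2 \<le> u \<bullet> (A *v u)"
proof -
  let ?q = "\<lambda>u. u \<bullet> (A *v u)"
  have "continuous_on (sphere 0 1) ?q"
    by (intro continuous_intros matrix_vector_mult_linear_continuous_on)
  then obtain v where v: "v \<in> sphere 0 1" and min: "\<And>u. u \<in> sphere 0 1 \<Longrightarrow> ?q v \<le> ?q u"
    using continuous_attains_inf[of "sphere 0 1" ?q] by auto
  have bound: "?q v * (norm u)\<^sup>2 \<le> ?q u" for u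
  proof (cases "u = 0")
    case False
    have "?q v \<le> ?q (sgn u)" by (rule min) (use False in \<open>simp add: norm_sgn\<close>)
    also have "\<dots> = ?q u / (norm u)\<^sup>2"
      by (simp add: sgn_div_norm matrix_vector_mult_scaleR power2_eq_square divide_inverse)
    finally show ?thesis using False by (simp add: pos_le_divide_eq)
  qed simp
  define B where "B = A - mat (?q v)"
  have Bu: "B *v u = A *v u - ?q v *\<^sub>R u" for u
  proof -
    have "mat (?q v) = ?q v *\<^sub>R (mat 1 :: real ^ 'n ^ 'n)"
      by (simp add: mat_def vec_eq_iff)
    then show ?thesis
      by (simp add: B_def matrix_vector_mult_diff_rdistrib flip: scaleR_matrix_vector_assoc)
  qed
  have "transpose B = B"
    using sym by (simp add: B_def transpose_def mat_def vec_eq_iff)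
  moreover have "0 \<le> u \<bullet> (B *v u)" for u
    using bound[of u] by (simp add: Bu inner_diff_right power2_norm_eq_inner)
  moreover have "v \<bullet> (B *v v) = 0"
    using v by (simp add: Bu inner_diff_right flip: power2_norm_eq_inner)
  ultimately have "B *v v = 0" by (rule psd_matrix_isotropic_imp_kernel)
  then have "eigenvalue A (?q v)"
    using v unfolding eigenvalue_def Bu by (intro exI[of _ v]) auto
  then show thesis using bound by (rule that)
qed

text \<open>Eigenvectors of a symmetric matrix for distinct eigenvalues are orthogonal, and a set of
  pairwise orthogonal vectors is finite in finite dimension.\<close>

lemma finite_eigenvalues_symmetric_matrix:
  fixes A :: "real ^ 'n ^ 'n"
  assumes sym: "transpose A = A"
  shows "finite {l. eigenvalue A l}"
proof -
  define v where "v l = (SOME v. v \<noteq> 0 \<and> A *v v = l *\<^sub>R v)" for l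
  have v: "v l \<noteq> 0" "A *v v l = l *\<^sub>R v l" if "eigenvalue A l" for l
    using someI_ex[OF that[unfolded eigenvalue_def]] by (simp_all add: v_def)
  have orth: "v l \<bullet> v k = 0" if "eigenvalue A l" "eigenvalue A k" "l \<noteq> k" for l k
    using inner_transpose_matrix_vector[of A "v l" "v k"] that v by (simp add: sym)
  have "inj_on v {l. eigenvalue A l}"
    by (rule inj_onI) (metis inner_eq_zero_iff mem_Collect_eq orth v(1))
  moreover have "pairwise orthogonal (v ` {l. eigenvalue A l})"
    using orth unfolding pairwise_def orthogonal_def by blast
  then have "finite (v ` {l. eigenvalue A l})"
    by (rule pairwise_orthogonal_imp_finite)
  ultimately show ?thesis by (rule finite_imageD[rotated])
qed

lemma full_row_rank_transpose_eq_0: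
  fixes X :: "real ^ 'p ^ 'n"
  assumes "rank X = CARD('n)" "transpose X *v u = 0"
  shows "u = 0"
proof -
  have "inj ((*v) (transpose X))"
    using assms(1) full_rank_injective[of "transpose X"] by (simp add: rank_transpose)
  then show ?thesis using assms(2) by (auto dest: injD[of _ u 0])
qed

text \<open>Full row rank makes every eigenvalue of \<open>X X\<^sup>T\<close> positive, and the smallest of them is at
  most the minimum of the Rayleigh quotient, since that minimum is itself an eigenvalue.\<close>

lemma smallest_singular_value_bound:
  fixes X :: "real ^ 'p ^ 'n"
  assumes rank: "rank X = CARD('n)"
  shows "0 < smallest_singular_value X"
    and "smallest_singular_value X * norm u \<le> norm (transpose X *v u)"
proof -
  let ?G = "X ** transpose X"
  have pos: "0 < l" if "eigenvalue ?G l" for l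
  proof -
    obtain v where v: "v \<noteq> 0" "?G *v v = l *\<^sub>R v"
      using \<open>eigenvalue ?G l\<close> by (auto simp: eigenvalue_def)
    then have "l * (norm v)\<^sup>2 = (norm (transpose X *v v))\<^sup>2"
      using inner_gram_matrix[of v X] by (simp add: power2_norm_eq_inner)
    moreover have "0 < (norm (transpose X *v v))\<^sup>2"
      using v full_row_rank_transpose_eq_0[OF rank] by auto
    ultimately show ?thesis using v(1)
      by (metis zero_less_mult_pos2 zero_less_norm_iff zero_less_power)
  qed
  obtain m where m: "eigenvalue ?G m" "\<And>u. m * (norm u)\<^sup>2 \<le> u \<bullet> (?G *v u)"
    using symmetric_matrix_min_eigenvalue[OF transpose_gram_matrix[of X]] by metis
  have S: "singular_values X = sqrt ` {l. eigenvalue ?G l}"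
    by (auto simp: singular_values_def)
  then have fin: "finite (singular_values X)"
    using finite_eigenvalues_symmetric_matrix[OF transpose_gram_matrix[of X]] by simp
  have mem: "sqrt m \<in> singular_values X" using m(1) by (auto simp: S)
  then have "smallest_singular_value X \<in> singular_values X"
    unfolding smallest_singular_value_def by (intro Min_in fin) auto
  then show "0 < smallest_singular_value X" using pos by (auto simp: S)
  have "smallest_singular_value X * norm u \<le> sqrt m * norm u"
    unfolding smallest_singular_value_def by (intro mult_right_mono Min_le fin mem) simp
  also have "\<dots> = sqrt (m * (norm u)\<^sup>2)" by (simp add: real_sqrt_mult)
  also have "\<dots> \<le> norm (transpose X *v u)"
    using m(2)[of u] by (intro real_le_lsqrt) (simp_all add: inner_gram_matrix)
  finally show "smallest_singular_value X * norm u \<le> norm (transpose X *v u)" .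
qed

text \<open>The witness \<open>w = X\<^sup>T u\<close> is the orthogonal projection of \<open>\<gamma>\<close> onto the row space of \<open>X\<close>, that is, the
  least-norm solution of \<open>X w = X \<gamma>\<close>.\<close>

lemma row_space_component:
  fixes X :: "real ^ 'p ^ 'n"
  assumes rank: "rank X = CARD('n)"
  obtains w where "X *v w = X *v \<gamma>" "smallest_singular_value X * norm w \<le> norm (X *v \<gamma>)"
proof -
  let ?G = "X ** transpose X"
  have "u = 0" if "?G *v u = 0" for u
    using inner_gram_matrix[of u X] that full_row_rank_transpose_eq_0[OF rank] by simp
  then have "inj ((*v) ?G)"
    by (intro linear_injective_0[OF matrix_vector_mul_linear, THEN iffD2]) blast
  then have "surj ((*v) ?G)"
    using linear_injective_imp_surjective matrix_vector_mul_linear by blast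
  then obtain u where u: "?G *v u = X *v \<gamma>" by (metis surjD)
  define w where "w = transpose X *v u"
  have Xw: "X *v w = X *v \<gamma>" by (metis u w_def matrix_vector_mul_assoc)
  let ?\<rho> = "smallest_singular_value X"
  have "?\<rho> * (norm w)\<^sup>2 = ?\<rho> * (u \<bullet> (X *v \<gamma>))"
    using inner_gram_matrix[of u X] by (simp only: u w_def)
  also have "\<dots> \<le> ?\<rho> * (norm u * norm (X *v \<gamma>))"
    using smallest_singular_value_bound(1)[OF rank] by (simp add: norm_cauchy_schwarz)
  also have "\<dots> \<le> norm w * norm (X *v \<gamma>)"
    using mult_right_mono[OF smallest_singular_value_bound(2)[OF rank, of u], of "norm (X *v \<gamma>)"]
    by (simp add: w_def mult.assoc)
  finally have "norm w * (?\<rho> * norm w) \<le> norm w * norm (X *v \<gamma>)"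
    by (simp add: power2_eq_square algebra_simps)
  then have "?\<rho> * norm w \<le> norm (X *v \<gamma>)"
    by (cases "w = 0") auto
  with Xw show thesis by (rule that)
qed

theorem theorem1p1:
  fixes X :: "real ^ 'p ^ 'n" and \<delta> \<rho> :: real
  assumes "CARD('n) \<le> CARD('p)"
    and "rank X = CARD('n)"
    and "\<delta> = distortion (matrix_kernel X)"
    and "\<rho> = smallest_singular_value X"
  shows "(\<forall>\<gamma> :: real ^ 'p.
            norm \<gamma> \<le> \<delta> / sqrt (real CARD('p)) * l1_norm \<gamma> + 2 * \<delta> / \<rho> * norm (X *v \<gamma>)) \<and>
         {\<gamma> :: real ^ 'p.
            \<delta> / sqrt (real CARD('p)) * l1_norm \<gamma> + 2 * \<delta> / \<rho> * norm (X *v \<gamma>) \<le> 1} \<subseteq> cball 0 1"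
proof -
  let ?s = "sqrt (real CARD('p))"
  have s: "0 < ?s" by simp
  have d: "has_distortion (matrix_kernel X) \<delta>"
    unfolding assms(3) by (rule has_distortion_distortion)
  then have d1: "1 \<le> \<delta>" by (simp add: has_distortion_def)
  have \<rho>: "0 < \<rho>" using smallest_singular_value_bound(1)[OF assms(2)] assms(4) by simp
  have main: "norm \<gamma> \<le> \<delta> / ?s * l1_norm \<gamma> + 2 * \<delta> / \<rho> * norm (X *v \<gamma>)" for \<gamma>
  proof -
    obtain w where w: "X *v w = X *v \<gamma>" "\<rho> * norm w \<le> norm (X *v \<gamma>)"
      using row_space_component[OF assms(2)] assms(4) by metis
    have "\<gamma> - w \<in> matrix_kernel X"
      using w(1) by (simp add: matrix_kernel_def matrix_vector_mult_diff_distrib)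
    then have "?s * norm (\<gamma> - w) \<le> \<delta> * l1_norm (\<gamma> - w)"
      using d by (simp add: has_distortion_def)
    also have "\<dots> \<le> \<delta> * (l1_norm \<gamma> + ?s * norm w)"
      using l1_norm_diff_le[of \<gamma> w] l1_norm_le_sqrt_norm[of w] d1 by (intro mult_left_mono) auto
    finally have "norm (\<gamma> - w) \<le> \<delta> * (l1_norm \<gamma> + ?s * norm w) / ?s"
      using s by (simp add: pos_le_divide_eq mult.commute)
    also have "\<dots> = \<delta> / ?s * l1_norm \<gamma> + \<delta> * norm w"
      using s by (simp add: field_simps)
    finally have z: "norm (\<gamma> - w) \<le> \<delta> / ?s * l1_norm \<gamma> + \<delta> * norm w" .
    have "norm w \<le> norm (X *v \<gamma>) / \<rho>"
      using w(2) \<rho> by (simp add: pos_le_divide_eq mult.commute)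
    then have "2 * \<delta> * norm w \<le> 2 * \<delta> * (norm (X *v \<gamma>) / \<rho>)"
      using d1 by (intro mult_left_mono) auto
    moreover have "norm w \<le> \<delta> * norm w"
      using d1 mult_right_mono[of 1 \<delta> "norm w"] by simp
    moreover have "norm \<gamma> \<le> norm (\<gamma> - w) + norm w"
      using norm_triangle_ineq[of "\<gamma> - w" w] by simp
    ultimately show ?thesis using z by simp
  qed
  moreover have "norm \<gamma> \<le> 1"
    if "\<delta> / ?s * l1_norm \<gamma> + 2 * \<delta> / \<rho> * norm (X *v \<gamma>) \<le> 1" for \<gamma>
    using order_trans[OF main that] .
  ultimately show ?thesis by (simp add: subset_iff)
qed

end
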